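(* Let $H$ be a real symmetric positive definite $n\times n$ matrix (with $n\ge 1$), let $\lambda\in(0,2)$, and let $N>0$ be an integer. Let $\varepsilon^*(N)$ be the exact worst-case performance measure factor of the relaxed proximal point algorithm, $$\varepsilon^*(N)=\sup_{F,\,\Omega,\,w,\,w_0}\ \frac{(\bar{w}_N-w)^TF(w)}{\|w-w_0\|_H^2},$$ where the supremum is over all monotone continuous mappings $F:\mathbb{R}^n\to\mathbb{R}^n$, all nonempty closed convex sets $\Omega\subseteq\mathbb{R}^n$, all $w_0\in\mathbb{R}^n$ and all $w\in\Omega$ with $w\ne w_0$, and where $\bar{w}_N=\frac{1}{N+1}\sum_{k=0}^N\tilde{w}_k$ with $\tilde{w}_0,\ldots,\tilde{w}_N$ the points generated from $w_0$ by the relaxed proximal point algorithm applied to $(F,\Omega)$ with parameters $H$ and $\lambda$. Then $$\varepsilon^*(N)=\frac{1}{2(\lambda N+2)}.$$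
   Context: A mapping $F:\mathbb{R}^n\to\mathbb{R}^n$ is monotone if $(x-y)^T(F(x)-F(y))\ge 0$ for all $x,y\in\mathbb{R}^n$. For a symmetric positive definite matrix $H$, $\|x\|_H=\sqrt{x^THx}$. Relaxed proximal point algorithm (RPPA) for $(F,\Omega)$ with parameters $H$ and $\lambda\in(0,2)$: starting from $w_0\in\mathbb{R}^n$, for $k=0,1,2,\ldots$, let $\tilde{w}_k\in\Omega$ be the (unique) point satisfying $$(w-\tilde{w}_k)^T\big[F(\tilde{w}_k)+H(\tilde{w}_k-w_k)\big]\ge 0\quad\text{for all } w\in\Omega,$$ and set $w_{k+1}=w_k+\lambda(\tilde{w}_k-w_k)$. *)

theory Defs
  imports "HOL-Analysis.Analysis"
begin

definition sym_posdef :: "real ^ 'n ^ 'n \<Rightarrow> bool" where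
  "sym_posdef H \<longleftrightarrow> transpose H = H \<and> (\<forall>x. x \<noteq> 0 \<longrightarrow> 0 < x \<bullet> (H *v x))"

definition norm_wrt :: "real ^ 'n ^ 'n \<Rightarrow> real ^ 'n \<Rightarrow> real" where
  "norm_wrt H x = sqrt (x \<bullet> (H *v x))"

definition monotone_map :: "(real ^ 'n \<Rightarrow> real ^ 'n) \<Rightarrow> bool" where
  "monotone_map F \<longleftrightarrow> (\<forall>x y. 0 \<le> (x - y) \<bullet> (F x - F y))"

definition is_prox_point ::
  "(real ^ 'n \<Rightarrow> real ^ 'n) \<Rightarrow> (real ^ 'n) set \<Rightarrow> real ^ 'n ^ 'n \<Rightarrow> real ^ 'n \<Rightarrow> real ^ 'n \<Rightarrow> bool" where
  "is_prox_point F \<Omega> H v z \<longleftrightarrow>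
     z \<in> \<Omega> \<and> (\<forall>w\<in>\<Omega>. 0 \<le> (w - z) \<bullet> (F z + H *v (z - v)))"

text \<open>The description below is justified by lemma \<open>ex1_prox_point\<close>.\<close>

definition prox_point ::
  "(real ^ 'n \<Rightarrow> real ^ 'n) \<Rightarrow> (real ^ 'n) set \<Rightarrow> real ^ 'n ^ 'n \<Rightarrow> real ^ 'n \<Rightarrow> real ^ 'n" where
  "prox_point F \<Omega> H v = (THE z. is_prox_point F \<Omega> H v z)"

primrec rppa_iterate ::
  "(real ^ 'n \<Rightarrow> real ^ 'n) \<Rightarrow> (real ^ 'n) set \<Rightarrow> real ^ 'n ^ 'n \<Rightarrow> real \<Rightarrow> real ^ 'n \<Rightarrow> nat \<Rightarrow> real ^ 'n" where
  "rppa_iterate F \<Omega> H lam w0 0 = w0"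
| "rppa_iterate F \<Omega> H lam w0 (Suc k) =
     (let wk = rppa_iterate F \<Omega> H lam w0 k in wk + lam *\<^sub>R (prox_point F \<Omega> H wk - wk))"

definition rppa_point ::
  "(real ^ 'n \<Rightarrow> real ^ 'n) \<Rightarrow> (real ^ 'n) set \<Rightarrow> real ^ 'n ^ 'n \<Rightarrow> real \<Rightarrow> real ^ 'n \<Rightarrow> nat \<Rightarrow> real ^ 'n" where
  "rppa_point F \<Omega> H lam w0 k = prox_point F \<Omega> H (rppa_iterate F \<Omega> H lam w0 k)"

definition rppa_average ::
  "(real ^ 'n \<Rightarrow> real ^ 'n) \<Rightarrow> (real ^ 'n) set \<Rightarrow> real ^ 'n ^ 'n \<Rightarrow> real \<Rightarrow> real ^ 'n \<Rightarrow> nat \<Rightarrow> real ^ 'n" where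
  "rppa_average F \<Omega> H lam w0 N =
     (1 / (real N + 1)) *\<^sub>R (\<Sum>k=0..N. rppa_point F \<Omega> H lam w0 k)"

text \<open>The supremum is taken in \<^typ>\<open>ereal\<close>, where it exists unconditionally; on \<^typ>\<open>real\<close>,
  \<^const>\<open>Sup\<close> would be unspecified for a set that is not bounded above.\<close>

definition worst_case_factor :: "real ^ 'n ^ 'n \<Rightarrow> real \<Rightarrow> nat \<Rightarrow> ereal" where
  "worst_case_factor H lam N = Sup
     {ereal (((rppa_average F \<Omega> H lam w0 N - w) \<bullet> F w) / (norm_wrt H (w - w0))\<^sup>2) | F \<Omega> w w0.
        monotone_map F \<and> continuous_on UNIV F \<and>
        \<Omega> \<noteq> {} \<and> closed \<Omega> \<and> convex \<Omega> \<and> w \<in> \<Omega> \<and> w \<noteq> w0}"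

lemma prox_point_unique:
  assumes "sym_posdef H" "monotone_map F" "is_prox_point F \<Omega> H v y" "is_prox_point F \<Omega> H v z"
  shows "y = z"
proof (rule ccontr)
  assume "y \<noteq> z"
  then have "0 < (y - z) \<bullet> (H *v (y - z))"
    using assms(1) by (simp add: sym_posdef_def)
  moreover have "H *v (y - z) = H *v (y - v) - H *v (z - v)"
    by (simp add: matrix_vector_mult_diff_distrib)
  moreover have "0 \<le> (y - z) \<bullet> (F y - F z)"
    using assms(2) by (simp add: monotone_map_def)
  moreover have "0 \<le> (z - y) \<bullet> (F y + H *v (y - v))" "0 \<le> (y - z) \<bullet> (F z + H *v (z - v))"
    using assms(3,4) by (auto simp: is_prox_point_def)
  ultimately show False
    by (simp add: inner_add_right inner_diff_left inner_diff_right)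
qed

lemma compact_variational_inequality:
  fixes G :: "'a::euclidean_space \<Rightarrow> 'a"
  assumes C: "compact C" "convex C" "C \<noteq> {}" and G: "continuous_on UNIV G"
  obtains z where "z \<in> C" "\<And>w. w \<in> C \<Longrightarrow> 0 \<le> (w - z) \<bullet> G z"
proof -
  have cl: "closed C" using C(1) by (rule compact_imp_closed)
  let ?g = "\<lambda>x. closest_point C (x - G x)"
  have "continuous_on C (\<lambda>x. x - G x)"
    by (intro continuous_intros continuous_on_subset[OF G]) auto
  moreover have "continuous_on ((\<lambda>x. x - G x) ` C) (closest_point C)"
    using continuous_on_closest_point[OF C(2) cl C(3)] by blast
  ultimately have "continuous_on C (closest_point C \<circ> (\<lambda>x. x - G x))"
    by (rule continuous_on_compose)
  then have "continuous_on C ?g" by (simp add: o_def)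
  moreover have "?g \<in> C \<rightarrow> C" using closest_point_in_set[OF cl C(3)] by auto
  ultimately obtain z where z: "z \<in> C" "?g z = z"
    using brouwer[OF C, of ?g] by auto
  have "0 \<le> (w - z) \<bullet> G z" if "w \<in> C" for w
    using closest_point_dot[OF C(2) cl that, of "z - G z"] z(2)
    by (simp add: inner_commute)
  with z(1) that show ?thesis by blast
qed

lemma sym_posdef_coercive:
  fixes H :: "real ^ 'n ^ 'n"
  assumes "sym_posdef H"
  obtains c where "0 < c" "\<And>x. c * (norm x)\<^sup>2 \<le> x \<bullet> (H *v x)"
proof -
  let ?S = "sphere (0 :: real ^ 'n) 1"
  have "continuous_on ?S (\<lambda>x. x \<bullet> (H *v x))"
    by (intro continuous_intros)
  then obtain s where s: "s \<in> ?S" "\<And>x. x \<in> ?S \<Longrightarrow> s \<bullet> (H *v s) \<le> x \<bullet> (H *v x)"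
    using continuous_attains_inf[of ?S "\<lambda>x. x \<bullet> (H *v x)"] by auto
  have "s \<bullet> (H *v s) * (norm x)\<^sup>2 \<le> x \<bullet> (H *v x)" for x
  proof (cases "x = 0")
    case False
    define u where "u = (1 / norm x) *\<^sub>R x"
    have x: "x = norm x *\<^sub>R u" and u: "u \<in> ?S" using False by (auto simp: u_def)
    have "x \<bullet> (H *v x) = (norm x)\<^sup>2 * (u \<bullet> (H *v u))"
      by (subst (1 2) x) (simp add: matrix_vector_mult_scaleR power2_eq_square)
    then show ?thesis using s(2)[OF u] by (simp add: mult.commute mult_right_mono)
  qed simp
  moreover have "s \<noteq> 0" using s(1) by auto
  then have "0 < s \<bullet> (H *v s)" using assms by (simp add: sym_posdef_def)
  ultimately show ?thesis using that by blast
qed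

lemma prox_point_exists:
  fixes H :: "real ^ 'n ^ 'n"
  assumes H: "sym_posdef H" and F: "monotone_map F" "continuous_on UNIV F"
    and \<Omega>: "\<Omega> \<noteq> {}" "closed \<Omega>" "convex \<Omega>"
  shows "\<exists>z. is_prox_point F \<Omega> H v z"
proof -
  obtain c where c: "0 < c" "\<And>x. c * (norm x)\<^sup>2 \<le> x \<bullet> (H *v x)"
    using sym_posdef_coercive[OF H] by blast
  obtain a where a: "a \<in> \<Omega>" using \<Omega>(1) by blast
  define G where "G z = F z + H *v (z - v)" for z
  define r where "r = norm (G a) / c + 1"
  have r: "0 < r" using c(1) by (simp add: r_def add_nonneg_pos)
  let ?C = "\<Omega> \<inter> cball a r"
  have "continuous_on UNIV G"
    unfolding G_def matrix_vector_mult_diff_distrib by (intro continuous_intros F(2))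
  moreover have "compact ?C"
    by (rule closed_Int_compact[OF \<Omega>(2) compact_cball])
  moreover have "convex ?C"
    by (rule convex_Int[OF \<Omega>(3) convex_cball])
  moreover have "a \<in> ?C" using a r by simp
  then have "?C \<noteq> {}" by blast
  ultimately obtain z where z: "z \<in> ?C" "\<And>w. w \<in> ?C \<Longrightarrow> 0 \<le> (w - z) \<bullet> G z"
    using compact_variational_inequality[of ?C G] by auto
  have strong: "c * (norm (z - a))\<^sup>2 \<le> (z - a) \<bullet> (G z - G a)"
  proof -
    have "G z - G a = (F z - F a) + H *v (z - a)"
      by (simp add: G_def matrix_vector_mult_diff_distrib)
    moreover have "0 \<le> (z - a) \<bullet> (F z - F a)" using F(1) by (simp add: monotone_map_def)
    ultimately show ?thesis using c(2)[of "z - a"] by (simp add: inner_add_right)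
  qed
  have "norm (z - a) < r"
  proof (cases "z = a")
    case False
    have "0 \<le> (a - z) \<bullet> G z" using z(2)[of a] a r by simp
    with strong have "c * (norm (z - a))\<^sup>2 \<le> - ((z - a) \<bullet> G a)"
      by (simp add: inner_diff_left inner_diff_right)
    also have "\<dots> \<le> norm (z - a) * norm (G a)"
      using norm_cauchy_schwarz[of "- (z - a)" "G a"] by (metis inner_minus_left norm_minus_cancel)
    finally have "c * norm (z - a) \<le> norm (G a)"
      using False by (simp add: power2_eq_square mult.left_commute)
    then have "norm (z - a) \<le> norm (G a) / c" using c(1) by (simp add: field_simps)
    then show ?thesis by (simp add: r_def)
  qed (use r in simp)
  then have inner: "0 < r - norm (z - a)" by simp
  have "0 \<le> (w - z) \<bullet> G z" if w: "w \<in> \<Omega>" for w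
  proof (cases "w = z")
    case False
    define t where "t = min 1 ((r - norm (z - a)) / norm (w - z))"
    have t: "0 < t" "t \<le> 1" using inner False by (auto simp: t_def)
    have tn: "t * norm (w - z) \<le> r - norm (z - a)"
      using False by (simp add: t_def pos_le_divide_eq [symmetric])
    let ?y = "z + t *\<^sub>R (w - z)"
    have "?y = (1 - t) *\<^sub>R z + t *\<^sub>R w" by (simp add: algebra_simps)
    then have "?y \<in> \<Omega>" using convexD_alt[OF \<Omega>(3), of z w t] z(1) w t by simp
    moreover have y: "?y - a = (z - a) + t *\<^sub>R (w - z)" by simp
    have "norm (?y - a) \<le> norm (z - a) + t * norm (w - z)"
      unfolding y using norm_triangle_ineq[of "z - a" "t *\<^sub>R (w - z)"] t(1) by simp
    then have "?y \<in> cball a r" using tn by (simp add: dist_norm norm_minus_commute)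
    ultimately have "0 \<le> (?y - z) \<bullet> G z" using z(2) by blast
    then show ?thesis using t(1) by (simp add: zero_le_mult_iff)
  qed simp
  then show ?thesis using z(1) by (auto simp: is_prox_point_def G_def)
qed

lemma ex1_prox_point:
  fixes H :: "real ^ 'n ^ 'n"
  assumes "sym_posdef H" "monotone_map F" "continuous_on UNIV F"
    and "\<Omega> \<noteq> {}" "closed \<Omega>" "convex \<Omega>"
  shows "\<exists>!z. is_prox_point F \<Omega> H v z"
  using prox_point_exists[OF assms] prox_point_unique[OF assms(1,2)] by metis

end

theory Submission
  imports Defs
begin

text \<open>Write \<open>B x y = x \<bullet> (H *v y)\<close> for the inner product of \<open>H\<close>, and let \<open>d\<^sub>k\<close> be the
  proximal displacement at step \<open>k\<close> (proximal point minus iterate), with sum \<open>D\<close> over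
  \<open>k = 0, \<dots>, N\<close>.

  Upper bound. Monotonicity moves \<open>F\<close> from \<open>w\<close> to the proximal point, and the variational
  inequality tested at \<open>w\<close> then bounds each summand of the performance measure by
  \<open>- B (x\<^sub>k + d\<^sub>k) d\<^sub>k\<close>, where \<open>x\<^sub>k\<close> is the error of the iterate (\<open>prox_gap_le\<close>).
  Since the errors are \<open>x\<^sub>0\<close> plus \<open>lam\<close> times the partial sums of the displacements, the total
  is a function of \<open>x\<^sub>0\<close>, \<open>D\<close> and \<open>\<Sum> B d\<^sub>k d\<^sub>k\<close> only (\<open>sum_gap_identity\<close>), in which the last
  quantity has the coefficient \<open>-(1 - lam/2) < 0\<close>. Discarding that term would give only the
  factor \<open>1 / (2 lam (N + 1))\<close>; the sharp constant comes from bounding it by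
  \<open>B D D / (N + 1)\<close> (\<open>inner_wrt_sum_le\<close>). What remains is a concave quadratic in \<open>D\<close>, whose
  maximum, found by completing the square, is \<open>(N + 1) / (2 (lam N + 2)) * B x\<^sub>0 x\<^sub>0\<close>
  (\<open>neg_sum_gap_le\<close>).

  Sharpness. Equality throughout forces all displacements to be equal and parallel to \<open>x\<^sub>0\<close>,
  which is what a constant mapping on the whole space produces; the maximiser \<open>D\<close> of the
  quadratic determines the constant (\<open>rppa_average_const\<close>).\<close>


section \<open>The inner product of a symmetric positive definite matrix\<close>

definition inner_wrt :: "real ^ 'n ^ 'n \<Rightarrow> real ^ 'n \<Rightarrow> real ^ 'n \<Rightarrow> real" where
  "inner_wrt H x y = x \<bullet> (H *v y)"

lemma inner_wrt_add_left: "inner_wrt H (x + y) z = inner_wrt H x z + inner_wrt H y z"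
  by (simp add: inner_wrt_def inner_add_left)

lemma inner_wrt_add_right: "inner_wrt H x (y + z) = inner_wrt H x y + inner_wrt H x z"
  by (simp add: inner_wrt_def matrix_vector_right_distrib inner_add_right)

lemma inner_wrt_diff_left: "inner_wrt H (x - y) z = inner_wrt H x z - inner_wrt H y z"
  by (simp add: inner_wrt_def inner_diff_left)

lemma inner_wrt_diff_right: "inner_wrt H x (y - z) = inner_wrt H x y - inner_wrt H x z"
  by (simp add: inner_wrt_def matrix_vector_mult_diff_distrib inner_diff_right)

lemma inner_wrt_scaleR_left: "inner_wrt H (a *\<^sub>R x) y = a * inner_wrt H x y"
  by (simp add: inner_wrt_def)

lemma inner_wrt_scaleR_right: "inner_wrt H x (a *\<^sub>R y) = a * inner_wrt H x y"
  by (simp add: inner_wrt_def matrix_vector_mult_scaleR)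

lemmas inner_wrt_bilinear =
  inner_wrt_add_left inner_wrt_add_right inner_wrt_diff_left inner_wrt_diff_right
  inner_wrt_scaleR_left inner_wrt_scaleR_right

lemma inner_wrt_sum_left: "inner_wrt H (\<Sum>i\<in>A. f i) y = (\<Sum>i\<in>A. inner_wrt H (f i) y)"
  by (simp add: inner_wrt_def inner_sum_left)

lemma inner_wrt_commute:
  assumes "sym_posdef H"
  shows "inner_wrt H x y = inner_wrt H y x"
proof -
  have "x \<bullet> (H *v y) = (x v* H) \<bullet> y" by (simp add: dot_lmul_matrix)
  also have "x v* H = H *v x"
    using assms by (metis sym_posdef_def transpose_matrix_vector)
  finally show ?thesis by (simp add: inner_wrt_def inner_commute)
qed

lemma inner_wrt_pos: "sym_posdef H \<Longrightarrow> x \<noteq> 0 \<Longrightarrow> 0 < inner_wrt H x x"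
  by (simp add: inner_wrt_def sym_posdef_def)

lemma inner_wrt_nonneg: "sym_posdef H \<Longrightarrow> 0 \<le> inner_wrt H x x"
  using inner_wrt_pos[of H x] by (cases "x = 0") (auto simp: inner_wrt_def)

lemma norm_wrt_squared: "sym_posdef H \<Longrightarrow> (norm_wrt H x)\<^sup>2 = inner_wrt H x x"
  using inner_wrt_nonneg[of H x] by (simp add: norm_wrt_def inner_wrt_def)

text \<open>The Cauchy--Schwarz inequality for a sum, in the form that the variance of the family
  \<open>d\<close> about its mean is nonnegative.\<close>

lemma inner_wrt_sum_le:
  assumes H: "sym_posdef H" and A: "finite A" "A \<noteq> {}"
  shows "inner_wrt H (\<Sum>k\<in>A. d k) (\<Sum>k\<in>A. d k) \<le> real (card A) * (\<Sum>k\<in>A. inner_wrt H (d k) (d k))"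
proof -
  define D where "D = (\<Sum>k\<in>A. d k)"
  define c where "c = real (card A)"
  have c: "0 < c" using A by (simp add: c_def card_gt_0_iff)
  have "0 \<le> (\<Sum>k\<in>A. inner_wrt H (c *\<^sub>R d k - D) (c *\<^sub>R d k - D))"
    by (intro sum_nonneg inner_wrt_nonneg[OF H])
  also have "\<dots> = (\<Sum>k\<in>A. c\<^sup>2 * inner_wrt H (d k) (d k) - 2 * c * inner_wrt H (d k) D + inner_wrt H D D)"
    by (intro sum.cong refl)
      (simp add: inner_wrt_bilinear inner_wrt_commute[OF H, of D "d _"] power2_eq_square algebra_simps)
  also have "\<dots> = c\<^sup>2 * (\<Sum>k\<in>A. inner_wrt H (d k) (d k)) - 2 * c * inner_wrt H D D + c * inner_wrt H D D"
    by (simp add: sum.distrib sum_subtractf sum_distrib_left[symmetric]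
        inner_wrt_sum_left[symmetric] D_def[symmetric] c_def)
  also have "\<dots> = c * (c * (\<Sum>k\<in>A. inner_wrt H (d k) (d k)) - inner_wrt H D D)"
    by (simp add: power2_eq_square algebra_simps)
  finally show ?thesis using c by (simp add: zero_le_mult_iff D_def c_def)
qed


section \<open>Sums along a relaxed iteration\<close>

lemma relaxed_sequence_eq:
  fixes x d :: "nat \<Rightarrow> 'a::real_vector"
  assumes "\<And>k. x (Suc k) = x k + lam *\<^sub>R d k"
  shows "x n = x 0 + lam *\<^sub>R (\<Sum>k<n. d k)"
  by (induction n) (simp_all add: assms scaleR_add_right)

text \<open>With \<open>B\<close> for the inner product of \<open>H\<close> and \<open>D\<close> for the sum of the \<open>d\<^sub>k\<close>, the double
  sum of \<open>B d\<^sub>j d\<^sub>k\<close> over \<open>j < k\<close> is half of \<open>B D D\<close> without its diagonal; hence the split of the unit coefficient of the diagonal into \<open>lam/2\<close> and \<open>1 - lam/2\<close>.\<close>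

lemma sum_gap_identity:
  assumes H: "sym_posdef H" and x: "\<And>k. x (Suc k) = x k + lam *\<^sub>R d k"
  shows "(\<Sum>k<n. inner_wrt H (x k + d k) (d k)) =
    inner_wrt H (x 0) (\<Sum>k<n. d k) + lam / 2 * inner_wrt H (\<Sum>k<n. d k) (\<Sum>k<n. d k)
      + (1 - lam / 2) * (\<Sum>k<n. inner_wrt H (d k) (d k))"
proof (induction n)
  case 0
  show ?case by (simp add: inner_wrt_def)
next
  case (Suc n)
  then show ?case
    by (simp add: relaxed_sequence_eq[of x lam d n, OF x] inner_wrt_bilinear
        inner_wrt_commute[OF H, of "d n" "\<Sum>k<n. d k"] algebra_simps)
qed

text \<open>By the variance inequality, the right-hand side of \<open>sum_gap_identity\<close> is at least a convex
  quadratic in the sum of the \<open>d\<^sub>k\<close>; the bound is the negative of its minimum.\<close>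

lemma neg_sum_gap_le:
  assumes H: "sym_posdef H" and lam: "0 < lam" "lam < 2"
    and x: "\<And>k. x (Suc k) = x k + lam *\<^sub>R d k"
  shows "- (\<Sum>k=0..N. inner_wrt H (x k + d k) (d k))
    \<le> (real N + 1) / (2 * (lam * real N + 2)) * inner_wrt H (x 0) (x 0)"
proof -
  define D where "D = (\<Sum>k<Suc N. d k)"
  define S where "S = (\<Sum>k<Suc N. inner_wrt H (d k) (d k))"
  define M where "M = real N + 1"
  define c where "c = lam * real N + 2"
  have M: "0 < M" and c: "0 < c" using lam by (auto simp: M_def c_def intro: add_nonneg_pos)
  have "inner_wrt H D D \<le> M * S"
    using inner_wrt_sum_le[OF H, of "{..<Suc N}" d] by (simp add: D_def S_def M_def lessThan_empty_iff add.commute)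
  then have "(1 - lam / 2) * (inner_wrt H D D / M) \<le> (1 - lam / 2) * S"
    using M lam by (intro mult_left_mono) (simp_all add: field_simps)
  moreover have "(\<Sum>k=0..N. inner_wrt H (x k + d k) (d k))
      = inner_wrt H (x 0) D + lam / 2 * inner_wrt H D D + (1 - lam / 2) * S"
    unfolding D_def S_def sum_gap_identity[OF H, where x = x and d = d and lam = lam, OF x, symmetric]
    by (simp only: atLeast0AtMost lessThan_Suc_atMost)
  moreover have "lam / 2 * inner_wrt H D D + (1 - lam / 2) * (inner_wrt H D D / M)
      = c / (2 * M) * inner_wrt H D D"
    using M by (simp add: c_def M_def field_simps)
  ultimately have "- (\<Sum>k=0..N. inner_wrt H (x k + d k) (d k))
      \<le> - inner_wrt H (x 0) D - c / (2 * M) * inner_wrt H D D"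
    by linarith
  also have "\<dots> = M / (2 * c) * inner_wrt H (x 0) (x 0)
      - inner_wrt H (M *\<^sub>R x 0 + c *\<^sub>R D) (M *\<^sub>R x 0 + c *\<^sub>R D) / (2 * M * c)"
    using M c by (simp add: inner_wrt_bilinear inner_wrt_commute[OF H, of D "x 0"] field_simps)
  also have "\<dots> \<le> M / (2 * c) * inner_wrt H (x 0) (x 0)"
    using M c inner_wrt_nonneg[OF H] by simp
  finally show ?thesis by (simp add: M_def c_def)
qed


section \<open>The upper bound\<close>

lemma prox_gap_le:
  assumes "monotone_map F" "is_prox_point F \<Omega> H v z" "w \<in> \<Omega>"
  shows "(z - w) \<bullet> F w \<le> - inner_wrt H (z - w) (z - v)"
proof -
  have "0 \<le> (z - w) \<bullet> (F z - F w)" using assms(1) by (simp add: monotone_map_def)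
  moreover have "0 \<le> (w - z) \<bullet> (F z + H *v (z - v))"
    using assms(2,3) by (simp add: is_prox_point_def)
  ultimately show ?thesis
    by (simp add: inner_wrt_def inner_diff_left inner_diff_right inner_add_right)
qed

lemma is_prox_point_prox_point:
  assumes "sym_posdef H" "monotone_map F" "continuous_on UNIV F"
    and "\<Omega> \<noteq> {}" "closed \<Omega>" "convex \<Omega>"
  shows "is_prox_point F \<Omega> H v (prox_point F \<Omega> H v)"
  unfolding prox_point_def by (rule theI'[OF ex1_prox_point[OF assms]])

lemma inner_rppa_average:
  "(rppa_average F \<Omega> H lam w0 N - w) \<bullet> u
    = (\<Sum>k=0..N. (rppa_point F \<Omega> H lam w0 k - w) \<bullet> u) / (real N + 1)"
  by (simp add: rppa_average_def inner_diff_left sum_subtractf inner_sum_left field_simps)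

lemma rppa_average_gap_le:
  assumes H: "sym_posdef H" and lam: "0 < lam" "lam < 2"
    and F: "monotone_map F" "continuous_on UNIV F"
    and \<Omega>: "\<Omega> \<noteq> {}" "closed \<Omega>" "convex \<Omega>" and w: "w \<in> \<Omega>"
  shows "(rppa_average F \<Omega> H lam w0 N - w) \<bullet> F w
    \<le> 1 / (2 * (lam * real N + 2)) * (norm_wrt H (w - w0))\<^sup>2"
proof -
  define x where "x k = rppa_iterate F \<Omega> H lam w0 k - w" for k
  define d where "d k = rppa_point F \<Omega> H lam w0 k - rppa_iterate F \<Omega> H lam w0 k" for k
  have x: "x (Suc k) = x k + lam *\<^sub>R d k" for k
    by (simp add: x_def d_def rppa_point_def Let_def)
  have "(rppa_point F \<Omega> H lam w0 k - w) \<bullet> F w \<le> - inner_wrt H (x k + d k) (d k)" for k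
    using prox_gap_le[OF F(1) is_prox_point_prox_point[OF H F \<Omega>] w, of "rppa_iterate F \<Omega> H lam w0 k"]
    by (simp add: x_def d_def rppa_point_def)
  then have "(\<Sum>k=0..N. (rppa_point F \<Omega> H lam w0 k - w) \<bullet> F w)
      \<le> - (\<Sum>k=0..N. inner_wrt H (x k + d k) (d k))"
    by (subst sum_negf[symmetric]) (rule sum_mono)
  also have "\<dots> \<le> (real N + 1) / (2 * (lam * real N + 2)) * inner_wrt H (x 0) (x 0)"
    using x by (rule neg_sum_gap_le[OF H lam])
  also have "inner_wrt H (x 0) (x 0) = (norm_wrt H (w - w0))\<^sup>2"
    by (simp add: norm_wrt_squared[OF H] x_def inner_wrt_bilinear)
  finally show ?thesis
    unfolding inner_rppa_average by (simp add: pos_divide_le_eq mult_ac)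
qed


section \<open>Constant mappings attain the bound\<close>

lemma prox_point_const:
  assumes H: "sym_posdef H"
  shows "prox_point (\<lambda>_. H *v q) UNIV H v = v - q"
proof -
  have "is_prox_point (\<lambda>_. H *v q) UNIV H v (v - q)"
    using matrix_vector_mult_diff_distrib[of H 0 q] by (simp add: is_prox_point_def)
  then show ?thesis
    unfolding prox_point_def
    by (rule the_equality) (rule prox_point_unique[OF H _ _ \<open>is_prox_point _ _ _ _ _\<close>],
        simp_all add: monotone_map_def)
qed

lemma rppa_average_const:
  assumes H: "sym_posdef H"
  shows "rppa_average (\<lambda>_. H *v q) UNIV H lam w0 N = w0 - (lam * real N / 2 + 1) *\<^sub>R q"
proof -
  have it: "rppa_iterate (\<lambda>_. H *v q) UNIV H lam w0 k = w0 - (lam * real k) *\<^sub>R q" for k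
    by (induction k) (simp_all add: prox_point_const[OF H] Let_def algebra_simps)
  have pt: "rppa_point (\<lambda>_. H *v q) UNIV H lam w0 k = w0 - (lam * real k + 1) *\<^sub>R q" for k
    by (simp add: rppa_point_def prox_point_const[OF H] it algebra_simps)
  have "(\<Sum>k=0..N. rppa_point (\<lambda>_. H *v q) UNIV H lam w0 k)
      = (real N + 1) *\<^sub>R (w0 - (lam * real N / 2 + 1) *\<^sub>R q)"
    by (induction N) (simp_all add: pt vec_eq_iff field_simps)
  then show ?thesis by (simp add: rppa_average_def)
qed

theorem mainTheorem2:
  fixes H :: "real ^ 'n ^ 'n" and lam :: real and N :: nat
  assumes "sym_posdef H"
    and "0 < lam" and "lam < 2"
    and "0 < N"
  shows "worst_case_factor H lam N = ereal (1 / (2 * (lam * real N + 2)))"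
proof (rule antisym)
  show "worst_case_factor H lam N \<le> ereal (1 / (2 * (lam * real N + 2)))"
    unfolding worst_case_factor_def
  proof (rule Sup_least, clarify)
    fix F :: "real ^ 'n \<Rightarrow> real ^ 'n" and \<Omega> and w w0 :: "real ^ 'n"
    assume "monotone_map F" "continuous_on UNIV F" "\<Omega> \<noteq> {}" "closed \<Omega>" "convex \<Omega>" "w \<in> \<Omega>"
      and "w \<noteq> w0"
    moreover have "0 < (norm_wrt H (w - w0))\<^sup>2"
      using \<open>w \<noteq> w0\<close> by (simp add: norm_wrt_squared inner_wrt_pos assms(1))
    ultimately show "ereal (((rppa_average F \<Omega> H lam w0 N - w) \<bullet> F w) / (norm_wrt H (w - w0))\<^sup>2)
        \<le> ereal (1 / (2 * (lam * real N + 2)))"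
      using rppa_average_gap_le[OF assms(1-3), of F \<Omega> w w0 N]
      by (simp add: pos_divide_le_eq)
  qed
next
  define c where "c = lam * real N + 2"
  have c: "0 < c" using assms(2) by (simp add: c_def add_nonneg_pos)
  \<comment> \<open>Only \<open>u \<noteq> 0\<close> matters. With \<open>w = 0\<close> and start \<open>u\<close>, the step \<open>t *\<^sub>R u\<close> yields the
    factor \<open>t - c / 2 * t\<^sup>2\<close>, which is largest at \<open>t = 1 / c\<close>.\<close>
  define u :: "real ^ 'n" where "u = 1"
  define F :: "real ^ 'n \<Rightarrow> real ^ 'n" where "F = (\<lambda>_. H *v ((1 / c) *\<^sub>R u))"
  have u: "u \<noteq> 0" by (simp add: u_def)
  then have pos: "0 < inner_wrt H u u" by (rule inner_wrt_pos[OF assms(1)])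
  have "rppa_average F UNIV H lam u N = (1 / 2) *\<^sub>R u"
  proof -
    have step: "lam * real N / 2 + 1 = c / 2" by (simp add: c_def)
    show ?thesis
      unfolding F_def rppa_average_const[OF assms(1)] step using c
      by (simp add: vec_eq_iff)
  qed
  moreover have "(norm_wrt H (0 - u))\<^sup>2 = inner_wrt H u u"
    unfolding norm_wrt_squared[OF assms(1)] inner_wrt_bilinear by (simp add: inner_wrt_def)
  ultimately have "((rppa_average F UNIV H lam u N - 0) \<bullet> F 0) / (norm_wrt H (0 - u))\<^sup>2 = 1 / (2 * c)"
    using pos c
    by (simp add: F_def inner_wrt_def matrix_vector_mult_scaleR)
  moreover have "monotone_map F" "continuous_on UNIV F"
    by (simp_all add: F_def monotone_map_def)
  ultimately show "ereal (1 / (2 * (lam * real N + 2))) \<le> worst_case_factor H lam N"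
    unfolding worst_case_factor_def c_def[symmetric] using u
    by (intro Sup_upper CollectI exI[of _ F] exI[of _ UNIV] exI[of _ 0] exI[of _ u]) auto
qed

end
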